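(* Let $f,g:S^1\times[0,\infty)\to(0,\infty)$ be smooth positive functions such that the metrics $f^2dx^2+g^2(dy^2+dz^2)$ on $S^1\times(\mathbb{R}/\mathbb{Z})^2$ solve the cross curvature flow $\frac{\partial}{\partial t}g_{ij}=2h_{ij}$, and assume $\max_{S^1}g(\cdot,0)>\min_{S^1}g(\cdot,0)$. Then the length $L(t)=\int_{S^1}f(x,t)\,dx$ of the orbit circle tends to infinity as $t\to\infty$.
   Context: For a Riemannian 3-manifold with metric $g_{ij}$, let $P^{ij}=g^{ik}g^{jl}R_{kl}-\frac12Rg^{ij}$ and let the cross curvature tensor be $h_{ij}=\frac{\det P^{kl}}{\det g^{kl}}V_{ij}$, where $V_{ij}$ is the inverse of $P^{ij}$ (with $(\det P^{kl})V_{ij}$ interpreted as the adjugate matrix of $P^{ij}$ when $P^{ij}$ is not invertible). Here $x$ is a coordinate on the orbit circle $S^1$ and $(y,z)$ are coordinates on the square torus fibre; $ds=f\,dx$ is the arc length on the orbit circle. With $\frac{\partial}{\partial s}=\frac1f\frac{\partial}{\partial x}$, the flow $\frac{\partial}{\partial t}g_{ij}=2h_{ij}$ for these metrics is equivalent to $\frac{\partial f}{\partial t}=\frac{f}{g^2}\left(\frac{\partial^2g}{\partial s^2}\right)^2$, $\frac{\partial g}{\partial t}=\frac1{g^2}\left(\frac{\partial g}{\partial s}\right)^2\frac{\partial^2g}{\partial s^2}$. *)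

theory Defs
  imports "HOL-Analysis.Analysis"
begin

text \<open>
  Derivatives are taken within the set, so for closed half spaces
  (where they are unique) smoothness includes the boundary, with one-sided derivatives there.
\<close>

primrec k_times_differentiable_on ::
    "nat \<Rightarrow> ('a::euclidean_space \<Rightarrow> real) \<Rightarrow> 'a set \<Rightarrow> bool" where
  "k_times_differentiable_on 0 F S \<longleftrightarrow> continuous_on S F"
| "k_times_differentiable_on (Suc k) F S \<longleftrightarrow>
     (\<exists>F'. (\<forall>p\<in>S. (F has_derivative F' p) (at p within S)) \<and>
           (\<forall>v. k_times_differentiable_on k (\<lambda>p. F' p v) S))"

definition smooth_on :: "('a::euclidean_space \<Rightarrow> real) \<Rightarrow> 'a set \<Rightarrow> bool" where
  "smooth_on F S \<longleftrightarrow> (\<forall>k. k_times_differentiable_on k F S)"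

text \<open>
  A metric on a coordinate domain is its matrix of components
  \<open>G p $ i $ j\<close> at the point \<open>p\<close>; metrics on a torus are
  given by their periodic lifts to the universal cover.
\<close>

definition coord_deriv :: "'n::finite \<Rightarrow> (real^'n \<Rightarrow> real) \<Rightarrow> real^'n \<Rightarrow> real" where
  "coord_deriv i F p = deriv (\<lambda>h. F (p + h *\<^sub>R axis i 1)) 0"

definition christoffel ::
    "(real^'n \<Rightarrow> real^'n^'n) \<Rightarrow> 'n::finite \<Rightarrow> 'n \<Rightarrow> 'n \<Rightarrow> real^'n \<Rightarrow> real" where
  \<comment> \<open>\<open>christoffel G k i j\<close> has upper index \<open>k\<close> and lower indices \<open>i, j\<close>\<close>
  "christoffel G k i j p =
     (1/2) * (\<Sum>l\<in>UNIV. matrix_inv (G p) $ k $ l *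
        (coord_deriv i (\<lambda>q. G q $ j $ l) p + coord_deriv j (\<lambda>q. G q $ i $ l) p
         - coord_deriv l (\<lambda>q. G q $ i $ j) p))"

definition riemann ::
    "(real^'n \<Rightarrow> real^'n^'n) \<Rightarrow> 'n::finite \<Rightarrow> 'n \<Rightarrow> 'n \<Rightarrow> 'n \<Rightarrow> real^'n \<Rightarrow> real" where
  \<comment> \<open>the \<open>l\<close>-th component of
    \<open>\<nabla>\<^sub>i \<nabla>\<^sub>j \<partial>\<^sub>k - \<nabla>\<^sub>j \<nabla>\<^sub>i \<partial>\<^sub>k\<close>\<close>
  "riemann G l k i j p =
     coord_deriv i (christoffel G l j k) p - coord_deriv j (christoffel G l i k) p
     + (\<Sum>m\<in>UNIV. christoffel G l i m p * christoffel G m j k p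
                 - christoffel G l j m p * christoffel G m i k p)"

text \<open>The sign is such that round spheres have positive Ricci curvature.\<close>

definition ricci :: "(real^'n \<Rightarrow> real^'n^'n) \<Rightarrow> real^'n \<Rightarrow> real^'n^'n" where
  "ricci G p = (\<chi> j k. \<Sum>i\<in>UNIV. riemann G i k i j p)"

definition scalar_curvature :: "(real^'n \<Rightarrow> real^'n^'n) \<Rightarrow> real^'n \<Rightarrow> real" where
  "scalar_curvature G p =
     (\<Sum>i\<in>UNIV. \<Sum>j\<in>UNIV. matrix_inv (G p) $ i $ j * ricci G p $ i $ j)"

definition einstein_upper :: "(real^'n \<Rightarrow> real^'n^'n) \<Rightarrow> real^'n \<Rightarrow> real^'n^'n" where
  "einstein_upper G p = (\<chi> i j.
     (\<Sum>k\<in>UNIV. \<Sum>l\<in>UNIV.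
        matrix_inv (G p) $ i $ k * matrix_inv (G p) $ j $ l * ricci G p $ k $ l)
     - (1/2) * scalar_curvature G p * matrix_inv (G p) $ i $ j)"

text \<open>
  The \<open>(i, j)\<close> entry is the \<open>(j, i)\<close> cofactor, obtained by
  replacing the \<open>j\<close>-th row by the \<open>i\<close>-th unit vector.
\<close>

definition adjugate :: "real^'n^'n \<Rightarrow> real^'n^'n" where
  "adjugate A = (\<chi> i j. det (\<chi> k. if k = j then axis i 1 else A $ k))"

definition det_times_inverse :: "real^'n^'n \<Rightarrow> real^'n^'n" where
  "det_times_inverse A = (if invertible A then det A *\<^sub>R matrix_inv A else adjugate A)"

definition cross_curvature :: "(real^3 \<Rightarrow> real^3^3) \<Rightarrow> real^3 \<Rightarrow> real^3^3" where
  "cross_curvature G p =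
     (1 / det (matrix_inv (G p))) *\<^sub>R det_times_inverse (einstein_upper G p)"

definition cross_curvature_flow :: "(real \<Rightarrow> real^3 \<Rightarrow> real^3^3) \<Rightarrow> bool" where
  "cross_curvature_flow G \<longleftrightarrow>
     (\<forall>t\<ge>0. \<forall>p. ((\<lambda>\<tau>. G \<tau> p) has_vector_derivative 2 *\<^sub>R cross_curvature (G t) p)
                   (at t within {0..}))"

text \<open>
  The metric \<open>f\<^sup>2 dx\<^sup>2 + g\<^sup>2 (dy\<^sup>2 + dz\<^sup>2)\<close>
  in the coordinates \<open>(x, y, z) = (p$1, p$2, p$3)\<close>.
\<close>

definition square_torus_bundle_metric ::
    "(real \<Rightarrow> real) \<Rightarrow> (real \<Rightarrow> real) \<Rightarrow> real^3 \<Rightarrow> real^3^3" where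
  "square_torus_bundle_metric f g p =
     (\<chi> i j. if i \<noteq> j then 0 else if i = 1 then (f (p $ 1))\<^sup>2 else (g (p $ 1))\<^sup>2)"

end

theory Submission
  imports Defs "HOL-Library.Periodic_Fun"
begin

text \<open>
  Write \<open>ds = f dx\<close>, and let subscripts denote partial derivatives. Computing the curvature of
  \<open>f\<^sup>2 dx\<^sup>2 + g\<^sup>2 (dy\<^sup>2 + dz\<^sup>2)\<close> turns the cross curvature flow into
  \<open>f\<^sub>t = f g\<^sub>s\<^sub>s\<^sup>2 / g\<^sup>2\<close> and \<open>g\<^sub>t = g\<^sub>s\<^sup>2 g\<^sub>s\<^sub>s / g\<^sup>2\<close>
  (lemmas \<open>cross_curvature_bundle_metric\<close> and \<open>cross_curvature_flow_imp_pde\<close>).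

  The second equation degenerates where \<open>g\<^sub>s = 0\<close>. Differentiating it in \<open>x\<close> shows that at
  each fixed \<open>x\<close> the function \<open>t \<mapsto> g\<^sub>x(x, t)\<close> solves a homogeneous linear ordinary differential
  equation. Hence critical points of \<open>g\<close> stay critical, in both time directions, and \<open>g\<close> is
  constant in time at each of them (\<open>critical_point_persists\<close>, \<open>critical_value_constant\<close>).
  So the maximum \<open>M\<close> and the minimum of \<open>g\<close> do not depend on time; in particular the
  oscillation \<open>\<delta> > 0\<close> of \<open>g\<close> is conserved.

  The length satisfies \<open>L' = \<integral> g\<^sub>s\<^sub>s\<^sup>2 / g\<^sup>2 ds \<ge> M\<^sup>-\<^sup>2 \<integral> g\<^sub>s\<^sub>s\<^sup>2 ds\<close>. A function with a critical
  point and oscillation \<open>\<delta>\<close> on a circle of length \<open>L\<close> must bend: \<open>\<integral> g\<^sub>s\<^sub>s\<^sup>2 ds \<ge> \<delta>\<^sup>2 / L\<^sup>3\<close>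
  (\<open>bending_energy_lower_bound\<close>). Therefore \<open>(L\<^sup>4)' \<ge> 4 \<delta>\<^sup>2 / M\<^sup>2\<close>, and \<open>L\<close> grows at least
  like \<open>t powr (1/4)\<close>.
\<close>

section \<open>Cross curvature of square torus bundle metrics\<close>

text \<open>
  The diagonal matrix with entries \<open>a, b, b\<close>. All tensors attached to the metrics
  \<open>f\<^sup>2 dx\<^sup>2 + g\<^sup>2 (dy\<^sup>2 + dz\<^sup>2)\<close> have this shape.
\<close>

definition axial_matrix :: "real \<Rightarrow> real \<Rightarrow> real^3^3" where
  "axial_matrix a b = (\<chi> i j. if i \<noteq> j then 0 else if i = 1 then a else b)"

lemma axial_matrix_nth:
  "axial_matrix a b $ i $ j = (if i \<noteq> j then 0 else if i = 1 then a else b)"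
  by (simp add: axial_matrix_def)

lemma axial_matrix_mult:
  "axial_matrix a b ** axial_matrix c d = axial_matrix (a * c) (b * d)"
  by (simp add: vec_eq_iff matrix_matrix_mult_def axial_matrix_nth forall_3 sum_3)

lemma axial_matrix_one: "axial_matrix 1 1 = mat 1"
  by (simp add: vec_eq_iff axial_matrix_nth mat_def)

lemma det_axial_matrix: "det (axial_matrix a b) = a * b\<^sup>2"
  by (simp add: det_3 axial_matrix_nth power2_eq_square)

lemma matrix_inv_axial_matrix:
  assumes "a \<noteq> 0" "b \<noteq> 0"
  shows "matrix_inv (axial_matrix a b) = axial_matrix (1 / a) (1 / b)"
proof -
  let ?A = "axial_matrix a b" and ?B = "axial_matrix (1 / a) (1 / b)"
  have AB: "?A ** ?B = mat 1" "?B ** ?A = mat 1"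
    using assms by (simp_all add: axial_matrix_mult axial_matrix_one)
  then have "matrix_inv ?A ** ?A = mat 1"
    using someI[where P = "\<lambda>A'. ?A ** A' = mat 1 \<and> A' ** ?A = mat 1" and x = ?B]
    unfolding matrix_inv_def by blast
  then have "matrix_inv ?A ** (?A ** ?B) = ?B"
    by (simp only: matrix_mul_assoc matrix_mul_lid)
  then show ?thesis
    by (simp only: AB matrix_mul_rid)
qed

text \<open>
  The formula holds whether or not the matrix is invertible, so degenerate Einstein
  tensors need no separate treatment later.
\<close>

lemma det_times_inverse_axial_matrix:
  "det_times_inverse (axial_matrix a b) = axial_matrix (b\<^sup>2) (a * b)"
proof (cases "a = 0 \<or> b = 0")
  case True
  then have "\<not> invertible (axial_matrix a b)"
    by (auto simp: invertible_det_nz det_axial_matrix)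
  then show ?thesis
    by (simp add: det_times_inverse_def adjugate_def vec_eq_iff forall_3 det_3 axial_matrix_nth
        axis_def power2_eq_square)
next
  case False
  then have "invertible (axial_matrix a b)"
    by (auto simp: invertible_det_nz det_axial_matrix)
  with False show ?thesis
    by (simp add: det_times_inverse_def matrix_inv_axial_matrix det_axial_matrix vec_eq_iff
        axial_matrix_nth power2_eq_square)
qed

lemma square_torus_bundle_metric_eq:
  "square_torus_bundle_metric \<phi> \<gamma> p = axial_matrix ((\<phi> (p $ 1))\<^sup>2) ((\<gamma> (p $ 1))\<^sup>2)"
  by (simp add: square_torus_bundle_metric_def axial_matrix_def)

lemma coord_deriv_const [simp]: "coord_deriv i (\<lambda>q. c) p = 0"
  by (simp add: coord_deriv_def)

lemma coord_deriv_of_first: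
  fixes p :: "real^3"
  assumes "(u has_real_derivative u') (at (p $ 1))"
  shows "coord_deriv i (\<lambda>q. u (q $ 1)) p = (if i = 1 then u' else 0)"
proof (cases "i = 1")
  case True
  have "((\<lambda>h. u (h + p $ 1)) has_real_derivative u') (at 0)"
    using assms by (simp flip: DERIV_shift)
  then show ?thesis
    using True by (simp add: coord_deriv_def DERIV_imp_deriv add.commute)
next
  case False
  then show ?thesis by (simp add: coord_deriv_def axis_def)
qed

text \<open>
  For a function \<open>u\<close> on a curve with speed \<open>a\<close>, that is with \<open>ds = a dx\<close>, this is the
  value of \<open>\<partial>\<^sup>2u/\<partial>s\<^sup>2 = (1/a) \<partial>\<^sub>x ((1/a) \<partial>\<^sub>x u)\<close> in terms of the values of
  \<open>a, \<partial>\<^sub>x a, \<partial>\<^sub>x u, \<partial>\<^sub>x\<^sup>2 u\<close> at the point.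
\<close>

definition second_arclength_derivative :: "real \<Rightarrow> real \<Rightarrow> real \<Rightarrow> real \<Rightarrow> real" where
  "second_arclength_derivative a a' u' u'' = u'' / a\<^sup>2 - a' * u' / a ^ 3"

context
  fixes \<phi> \<gamma> \<phi>' \<gamma>' \<gamma>'' :: "real \<Rightarrow> real"
  assumes pos: "\<And>x. \<phi> x > 0" "\<And>x. \<gamma> x > 0"
    and d\<phi>: "\<And>x. (\<phi> has_real_derivative \<phi>' x) (at x)"
    and d\<gamma>: "\<And>x. (\<gamma> has_real_derivative \<gamma>' x) (at x)"
    and d\<gamma>': "\<And>x. (\<gamma>' has_real_derivative \<gamma>'' x) (at x)"
begin

lemma inverse_bundle_metric:
  "matrix_inv (square_torus_bundle_metric \<phi> \<gamma> p)
     = axial_matrix (1 / (\<phi> (p $ 1))\<^sup>2) (1 / (\<gamma> (p $ 1))\<^sup>2)"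
  using pos[of "p $ 1"] by (simp add: square_torus_bundle_metric_eq matrix_inv_axial_matrix)

lemma coord_deriv_bundle_metric:
  "coord_deriv k (\<lambda>q. square_torus_bundle_metric \<phi> \<gamma> q $ i $ j) p =
     (if k \<noteq> 1 \<or> i \<noteq> j then 0
      else if i = 1 then 2 * \<phi> (p $ 1) * \<phi>' (p $ 1) else 2 * \<gamma> (p $ 1) * \<gamma>' (p $ 1))"
proof -
  have "((\<lambda>x. (\<phi> x)\<^sup>2) has_real_derivative 2 * \<phi> (p $ 1) * \<phi>' (p $ 1)) (at (p $ 1))"
    "((\<lambda>x. (\<gamma> x)\<^sup>2) has_real_derivative 2 * \<gamma> (p $ 1) * \<gamma>' (p $ 1)) (at (p $ 1))"
    by (auto intro!: derivative_eq_intros d\<phi> d\<gamma>)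
  note coord_deriv_of_first[OF this(1)] coord_deriv_of_first[OF this(2)]
  then show ?thesis
    by (cases "i = j"; cases "i = 1") (simp_all add: square_torus_bundle_metric_eq axial_matrix_nth)
qed

lemma christoffel_bundle_metric:
  "christoffel (square_torus_bundle_metric \<phi> \<gamma>) k i j p =
     (if k = 1 then
        if i \<noteq> j then 0
        else if i = 1 then \<phi>' (p $ 1) / \<phi> (p $ 1)
        else - (\<gamma> (p $ 1) * \<gamma>' (p $ 1) / (\<phi> (p $ 1))\<^sup>2)
      else if i = 1 \<and> j = k \<or> i = k \<and> j = 1 then \<gamma>' (p $ 1) / \<gamma> (p $ 1) else 0)"
proof -
  have nz: "\<phi> (p $ 1) \<noteq> 0" "\<gamma> (p $ 1) \<noteq> 0"
    using pos[of "p $ 1"] by auto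
  have "k = 1 \<or> k = 2 \<or> k = 3" "i = 1 \<or> i = 2 \<or> i = 3" "j = 1 \<or> j = 2 \<or> j = 3"
    using exhaust_3 by blast+
  then show ?thesis
    unfolding christoffel_def coord_deriv_bundle_metric inverse_bundle_metric sum_3
    using nz by (elim disjE) (simp_all add: axial_matrix_nth power2_eq_square)
qed

text \<open>
  The factor \<open>\<phi>\<close> is only assumed to be differentiable once, so the derivative of
  \<open>\<Gamma>\<^sup>1\<^sub>1\<^sub>1 = \<phi>'/\<phi>\<close> stays unevaluated; it cancels in the Ricci tensor.
\<close>

lemma coord_deriv_christoffel_bundle_metric:
  "coord_deriv l (christoffel (square_torus_bundle_metric \<phi> \<gamma>) k i j) p =
     (if l \<noteq> 1 then 0 else if k = 1 then
        if i \<noteq> j then 0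
        else if i = 1 then deriv (\<lambda>x. \<phi>' x / \<phi> x) (p $ 1)
        else - (((\<gamma>' (p $ 1))\<^sup>2 + \<gamma> (p $ 1) * \<gamma>'' (p $ 1)) / (\<phi> (p $ 1))\<^sup>2
                - 2 * \<gamma> (p $ 1) * \<gamma>' (p $ 1) * \<phi>' (p $ 1) / (\<phi> (p $ 1)) ^ 3)
      else if i = 1 \<and> j = k \<or> i = k \<and> j = 1
        then \<gamma>'' (p $ 1) / \<gamma> (p $ 1) - (\<gamma>' (p $ 1) / \<gamma> (p $ 1))\<^sup>2 else 0)"
proof -
  have nz: "\<phi> x \<noteq> 0" "\<gamma> x \<noteq> 0" for x
    using pos[of x] by auto
  have 1: "((\<lambda>x. - (\<gamma> x * \<gamma>' x / (\<phi> x)\<^sup>2)) has_real_derivative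
     - (((\<gamma>' x)\<^sup>2 + \<gamma> x * \<gamma>'' x) / (\<phi> x)\<^sup>2 - 2 * \<gamma> x * \<gamma>' x * \<phi>' x / (\<phi> x) ^ 3)) (at x)" for x
    using nz by (auto intro!: derivative_eq_intros d\<phi> d\<gamma> d\<gamma>' simp: field_simps power2_eq_square power3_eq_cube)
  have 2: "((\<lambda>x. \<gamma>' x / \<gamma> x) has_real_derivative \<gamma>'' x / \<gamma> x - (\<gamma>' x / \<gamma> x)\<^sup>2) (at x)" for x
    using nz by (auto intro!: derivative_eq_intros d\<gamma> d\<gamma>' simp: field_simps power2_eq_square)
  have 3: "coord_deriv l (\<lambda>q. \<phi>' (q $ 1) / \<phi> (q $ 1)) p =
      (if l = 1 then deriv (\<lambda>x. \<phi>' x / \<phi> x) (p $ 1) else 0)" for l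
  proof (cases "l = 1")
    case True
    define u where "u x = \<phi>' x / \<phi> x" for x
    have "((\<lambda>h. u (p $ 1 + h)) has_real_derivative D) (at 0)
            \<longleftrightarrow> (u has_real_derivative D) (at (p $ 1))" for D
      using DERIV_shift[of u D 0 "p $ 1"] by (simp add: add.commute)
    then show ?thesis using True by (simp add: coord_deriv_def deriv_def flip: u_def)
  qed (simp add: coord_deriv_def axis_def)
  show ?thesis
    unfolding christoffel_bundle_metric[abs_def]
    by (cases "k = 1"; cases "i = j"; cases "i = 1"; cases "j = 1"; cases "i = k"; cases "j = k")
      (simp_all add: 3 1[THEN coord_deriv_of_first] 2[THEN coord_deriv_of_first])
qed

abbreviation \<kappa> :: "real \<Rightarrow> real" where
  "\<kappa> x \<equiv> second_arclength_derivative (\<phi> x) (\<phi>' x) (\<gamma>' x) (\<gamma>'' x)"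

lemma ricci_bundle_metric:
  "ricci (square_torus_bundle_metric \<phi> \<gamma>) p =
     axial_matrix (- 2 * (\<phi> (p $ 1))\<^sup>2 * \<kappa> (p $ 1) / \<gamma> (p $ 1))
       (- \<gamma> (p $ 1) * \<kappa> (p $ 1) - (\<gamma>' (p $ 1) / \<phi> (p $ 1))\<^sup>2)"
proof -
  have nz: "\<phi> (p $ 1) \<noteq> 0" "\<gamma> (p $ 1) \<noteq> 0"
    using pos[of "p $ 1"] by auto
  show ?thesis
    unfolding vec_eq_iff forall_3 ricci_def riemann_def vec_lambda_beta sum_3
      coord_deriv_christoffel_bundle_metric christoffel_bundle_metric
    using nz by (simp add: axial_matrix_nth second_arclength_derivative_def)
      (simp add: field_simps power2_eq_square power3_eq_cube)
qed

lemma einstein_upper_bundle_metric: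
  "einstein_upper (square_torus_bundle_metric \<phi> \<gamma>) p =
     axial_matrix ((\<gamma>' (p $ 1))\<^sup>2 / ((\<phi> (p $ 1))^4 * (\<gamma> (p $ 1))\<^sup>2)) (\<kappa> (p $ 1) / (\<gamma> (p $ 1)) ^ 3)"
proof -
  have nz: "\<phi> (p $ 1) \<noteq> 0" "\<gamma> (p $ 1) \<noteq> 0"
    using pos[of "p $ 1"] by auto
  show ?thesis
    unfolding vec_eq_iff forall_3 einstein_upper_def scalar_curvature_def vec_lambda_beta sum_3
      inverse_bundle_metric ricci_bundle_metric
    using nz by (simp add: axial_matrix_nth)
      (simp add: field_simps power2_eq_square power3_eq_cube power4_eq_xxxx)
qed

text \<open>
  With \<open>ds = \<phi> dx\<close>, the components are
  \<open>h\<^sub>x\<^sub>x = \<phi>\<^sup>2 \<gamma>\<^sub>s\<^sub>s\<^sup>2 / \<gamma>\<^sup>2\<close> and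
  \<open>h\<^sub>y\<^sub>y = h\<^sub>z\<^sub>z = \<gamma>\<^sub>s\<^sup>2 \<gamma>\<^sub>s\<^sub>s / \<gamma>\<close>.
\<close>

lemma cross_curvature_bundle_metric:
  "cross_curvature (square_torus_bundle_metric \<phi> \<gamma>) p =
     axial_matrix ((\<phi> (p $ 1) * \<kappa> (p $ 1) / \<gamma> (p $ 1))\<^sup>2)
       ((\<gamma>' (p $ 1) / \<phi> (p $ 1))\<^sup>2 * \<kappa> (p $ 1) / \<gamma> (p $ 1))"
proof -
  have nz: "\<phi> (p $ 1) \<noteq> 0" "\<gamma> (p $ 1) \<noteq> 0"
    using pos[of "p $ 1"] by auto
  show ?thesis
    unfolding cross_curvature_def inverse_bundle_metric einstein_upper_bundle_metric
      det_times_inverse_axial_matrix det_axial_matrix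
    using nz by (simp add: vec_eq_iff axial_matrix_nth)
      (simp add: field_simps power2_eq_square power3_eq_cube power4_eq_xxxx)
qed

end

section \<open>Oscillation and bending energy\<close>

lemma abs_diff_le_integral_abs_derivative:
  fixes w w' :: "real \<Rightarrow> real"
  assumes der: "\<And>x. x \<in> {a..b} \<Longrightarrow> (w has_real_derivative w' x) (at x within {a..b})"
    and cont: "continuous_on {a..b} w'"
    and pq: "p \<in> {a..b}" "q \<in> {a..b}"
  shows "\<bar>w p - w q\<bar> \<le> integral {a..b} (\<lambda>x. \<bar>w' x\<bar>)"
  using pq
proof (induction p q rule: linorder_wlog)
  case (le p q)
  then have sub: "{p..q} \<subseteq> {a..b}" by auto
  have "(w' has_integral w q - w p) {p..q}"
    using le sub by (intro fundamental_theorem_of_calculus)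
      (auto simp flip: has_real_derivative_iff_has_vector_derivative
        intro: has_field_derivative_subset[OF der sub])
  then have "\<bar>w p - w q\<bar> = norm (integral {p..q} w')"
    by (simp add: integral_unique abs_minus_commute)
  also have "\<dots> \<le> integral {p..q} (\<lambda>x. \<bar>w' x\<bar>)"
    using cont sub by (intro integral_norm_bound_integral integrable_continuous_interval
      continuous_intros) (auto intro: continuous_on_subset)
  also have "\<dots> \<le> integral {a..b} (\<lambda>x. \<bar>w' x\<bar>)"
    using cont sub by (intro integral_subset_le integrable_continuous_interval continuous_intros)
      (auto intro: continuous_on_subset)
  finally show ?case .
next
  case (sym p q)
  then show ?case by (simp add: abs_minus_commute)
qed

lemma integral_pos_of_continuous_pos:
  fixes a :: "real \<Rightarrow> real"
  assumes "continuous_on {0..1} a" "\<And>x. x \<in> {0..1} \<Longrightarrow> a x > 0"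
  shows "integral {0..1} a > 0"
proof -
  obtain m where m: "m \<in> {0..1}" "\<And>x. x \<in> {0..1} \<Longrightarrow> a m \<le> a x"
    using continuous_attains_inf[of "{0..1}" a] assms by auto
  have "integral {0..1} (\<lambda>x::real. a m) \<le> integral {0..1} a"
    using m assms by (intro integral_le integrable_continuous_interval) auto
  then show ?thesis using assms(2)[OF m(1)] by simp
qed

text \<open>
  With \<open>ds = a dx\<close> the hypotheses say \<open>\<sigma> = u\<^sub>s\<close> and \<open>S = u\<^sub>s\<^sub>s\<close>. A curve segment of length
  \<open>L\<close> along which \<open>u\<close> changes by \<open>\<delta>\<close> and has a critical point satisfies
  \<open>\<integral> u\<^sub>s\<^sub>s\<^sup>2 ds \<ge> \<delta>\<^sup>2 / L\<^sup>3\<close>: starting from the critical point, \<open>\<bar>u\<^sub>s\<bar> \<le> \<integral> \<bar>u\<^sub>s\<^sub>s\<bar> ds\<close>, hence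
  \<open>\<delta> \<le> L \<integral> \<bar>u\<^sub>s\<^sub>s\<bar> ds\<close>, and the Cauchy-Schwarz inequality gives the claim.
\<close>

lemma bending_energy_lower_bound:
  fixes a u \<sigma> S :: "real \<Rightarrow> real"
  assumes a: "continuous_on {0..1} a" "\<And>x. x \<in> {0..1} \<Longrightarrow> a x > 0"
    and S: "continuous_on {0..1} S"
    and du: "\<And>x. x \<in> {0..1} \<Longrightarrow> (u has_real_derivative a x * \<sigma> x) (at x within {0..1})"
    and d\<sigma>: "\<And>x. x \<in> {0..1} \<Longrightarrow> (\<sigma> has_real_derivative a x * S x) (at x within {0..1})"
    and c: "c \<in> {0..1}" "\<sigma> c = 0"
    and pq: "p \<in> {0..1}" "q \<in> {0..1}"
  shows "(u p - u q)\<^sup>2 / (integral {0..1} a) ^ 3 \<le> integral {0..1} (\<lambda>x. a x * (S x)\<^sup>2)"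
proof -
  define L where "L = integral {0..1} a"
  define I where "I = integral {0..1} (\<lambda>x. a x * \<bar>S x\<bar>)"
  define J where "J = integral {0..1} (\<lambda>x. a x * (S x)\<^sup>2)"
  define \<delta> where "\<delta> = \<bar>u p - u q\<bar>"
  have \<sigma>: "continuous_on {0..1} \<sigma>"
    using d\<sigma> by (meson DERIV_continuous continuous_on_eq_continuous_within)
  have a0: "0 \<le> a x" if "x \<in> {0..1}" for x
    using a(2)[OF that] by simp
  have L: "L > 0"
    unfolding L_def using a by (rule integral_pos_of_continuous_pos)
  have \<sigma>_le: "\<bar>\<sigma> x\<bar> \<le> I" if "x \<in> {0..1}" for x
  proof -
    have "\<bar>\<sigma> x - \<sigma> c\<bar> \<le> integral {0..1} (\<lambda>x. \<bar>a x * S x\<bar>)"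
      using that c a S by (intro abs_diff_le_integral_abs_derivative d\<sigma>) (auto intro!: continuous_intros)
    also have "\<dots> = I"
      unfolding I_def by (intro integral_cong) (use a0 in \<open>simp add: abs_mult\<close>)
    finally show ?thesis using c by simp
  qed
  have "\<delta> \<le> integral {0..1} (\<lambda>x. \<bar>a x * \<sigma> x\<bar>)"
    unfolding \<delta>_def
    using pq a \<sigma> by (intro abs_diff_le_integral_abs_derivative du) (auto intro!: continuous_intros)
  also have "\<dots> \<le> integral {0..1} (\<lambda>x. a x * I)"
    using a \<sigma> a0 \<sigma>_le by (intro integral_le integrable_continuous_interval continuous_intros)
      (auto simp: abs_mult intro!: mult_left_mono)
  also have "\<dots> = L * I"
    by (simp add: L_def)
  finally have \<delta>: "\<delta> \<le> L * I" .
  have "\<delta>\<^sup>2 \<le> J * L ^ 3"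
  proof (cases "\<delta> = 0")
    case True
    have "J \<ge> 0"
      unfolding J_def using a S a0 by (intro integral_nonneg integrable_continuous_interval continuous_intros) auto
    with True L show ?thesis by simp
  next
    case False
    then have \<delta>0: "\<delta> > 0" by (simp add: \<delta>_def)
    \<comment> \<open>Cauchy-Schwarz as the weighted bound \<open>2 k \<bar>S\<bar> \<le> S\<^sup>2 + k\<^sup>2\<close>;
      this \<open>k\<close> is the value of \<open>\<bar>S\<bar>\<close> in the equality case\<close>
    define k where "k = \<delta> / L\<^sup>2"
    have k: "k > 0" using \<delta>0 L by (simp add: k_def)
    have "2 * k * I = integral {0..1} (\<lambda>x. a x * (2 * k * \<bar>S x\<bar>))"
      unfolding I_def by (simp flip: integral_mult_right) (simp add: mult_ac)
    also have "\<dots> \<le> integral {0..1} (\<lambda>x. a x * (S x)\<^sup>2 + a x * k\<^sup>2)"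
    proof (intro integral_le integrable_continuous_interval continuous_intros a S)
      fix x :: real assume x: "x \<in> {0..1}"
      have "0 \<le> (\<bar>S x\<bar> - k)\<^sup>2" by simp
      then have "2 * k * \<bar>S x\<bar> \<le> (S x)\<^sup>2 + k\<^sup>2"
        by (simp add: power2_diff algebra_simps)
      then show "a x * (2 * k * \<bar>S x\<bar>) \<le> a x * (S x)\<^sup>2 + a x * k\<^sup>2"
        using a0[OF x] by (metis distrib_left mult_left_mono)
    qed
    also have "\<dots> = J + L * k\<^sup>2"
      unfolding J_def L_def using a S
      by (subst integral_add) (auto intro!: integrable_continuous_interval continuous_intros)
    finally have "2 * k * I \<le> J + L * k\<^sup>2" .
    moreover have "k * \<delta> / L \<le> k * I"
      using \<delta> L k by (simp add: field_simps)
    ultimately have "2 * (k * \<delta> / L) \<le> J + L * k\<^sup>2" by simp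
    moreover have "k * \<delta> / L = \<delta>\<^sup>2 / L ^ 3" "L * k\<^sup>2 = \<delta>\<^sup>2 / L ^ 3"
      using L by (simp_all add: k_def field_simps power2_eq_square power3_eq_cube)
    ultimately have "\<delta>\<^sup>2 / L ^ 3 \<le> J" by simp
    then show ?thesis using L by (simp add: field_simps)
  qed
  then show ?thesis
    using L by (simp add: \<delta>_def field_simps flip: L_def J_def)
qed

text \<open>
  The inequality \<open>L' \<ge> c / L\<^sup>3\<close> says that \<open>L\<^sup>4\<close> grows at least at the rate \<open>4 c\<close>.
\<close>

lemma filterlim_at_top_of_cubic_growth:
  fixes L L' :: "real \<Rightarrow> real"
  assumes pos: "\<And>t. t \<ge> 0 \<Longrightarrow> L t > 0"
    and der: "\<And>t. t \<ge> 0 \<Longrightarrow> (L has_real_derivative L' t) (at t within {0..})"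
    and c: "c > 0" "\<And>t. t \<ge> 0 \<Longrightarrow> L' t \<ge> c / (L t) ^ 3"
  shows "filterlim L at_top at_top"
proof -
  have growth: "4 * c * T \<le> (L T) ^ 4" if T: "T \<ge> 0" for T
  proof -
    define F where "F t = (L t) ^ 4 - 4 * c * t" for t
    have dF: "(F has_real_derivative 4 * (L t) ^ 3 * L' t - 4 * c) (at t within {0..})"
      if "t \<ge> 0" for t
      unfolding F_def using that by (auto intro!: derivative_eq_intros der)
    have "F 0 \<le> F T"
    proof (rule DERIV_nonneg_imp_increasing_open[OF T])
      fix t assume t: "0 < t" "t < T"
      have "at t within {0..} = at t"
        using t by (intro at_within_interior) simp
      then have "(F has_real_derivative 4 * (L t) ^ 3 * L' t - 4 * c) (at t)"
        using dF[of t] t by simp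
      moreover have "c \<le> L t ^ 3 * L' t"
        using c(2)[of t] pos[of t] t by (simp add: field_simps)
      ultimately show "\<exists>y. (F has_real_derivative y) (at t) \<and> 0 \<le> y"
        by (intro exI[of _ "4 * (L t) ^ 3 * L' t - 4 * c"]) auto
    next
      have "continuous_on {0..} F"
        using dF by (auto simp: continuous_on_eq_continuous_within intro!: DERIV_continuous)
      then show "continuous_on {0..T} F"
        by (rule continuous_on_subset) auto
    qed
    moreover have "(L 0) ^ 4 \<ge> 0" by simp
    ultimately show ?thesis unfolding F_def by linarith
  qed
  show ?thesis
  proof (subst filterlim_at_top_gt[of _ _ 0], intro allI impI)
    fix Z :: real assume Z: "Z > 0"
    show "\<forall>\<^sub>F t in at_top. Z \<le> L t"
      using eventually_ge_at_top[of "max 0 (Z ^ 4 / (4 * c))"]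
    proof eventually_elim
      case (elim t)
      then have "Z ^ 4 \<le> 4 * c * t"
        using c by (simp add: field_simps)
      also have "\<dots> \<le> (L t) ^ 4" using growth elim by simp
      finally show ?case
        using pos[of t] elim Z by (simp add: power_mono_iff)
    qed
  qed
qed

section \<open>Reduction of the flow to a system for two functions\<close>

lemma k_times_differentiable_on_imp_continuous_on:
  assumes "k_times_differentiable_on k F S"
  shows "continuous_on S F"
proof (cases k)
  case 0
  with assms show ?thesis by simp
next
  case (Suc m)
  with assms show ?thesis
    by (auto intro: has_derivative_continuous_on)
qed

lemma k_times_differentiable_on_partial_fst:
  assumes "k_times_differentiable_on (Suc k) (\<lambda>(x, t). u x t) (UNIV \<times> {0..})"
  obtains ux :: "real \<Rightarrow> real \<Rightarrow> real" where
    "k_times_differentiable_on k (\<lambda>(x, t). ux x t) (UNIV \<times> {0..})"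
    "\<And>x t. t \<ge> 0 \<Longrightarrow> ((\<lambda>x. u x t) has_real_derivative ux x t) (at x)"
proof -
  obtain F' where F': "\<And>p. p \<in> UNIV \<times> {0..} \<Longrightarrow>
        ((\<lambda>(x, t). u x t) has_derivative F' p) (at p within UNIV \<times> {0..})"
    and k: "\<And>v. k_times_differentiable_on k (\<lambda>p. F' p v) (UNIV \<times> {0..})"
    using assms by auto
  show ?thesis
  proof (rule that[of "\<lambda>x t. F' (x, t) (1, 0)"])
    show "k_times_differentiable_on k (\<lambda>(x, t). F' (x, t) (1, 0)) (UNIV \<times> {0..})"
      using k[of "(1, 0)"] by (simp add: case_prod_unfold)
  next
    fix x t :: real assume "t \<ge> 0"
    then have F: "((\<lambda>(x, t). u x t) has_derivative F' (x, t)) (at (x, t) within UNIV \<times> {0..})"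
      by (intro F') simp
    have F2: "((\<lambda>(x, t). u x t) has_derivative F' (x, t)) (at (x, t) within (\<lambda>x. (x, t)) ` UNIV)"
      using \<open>t \<ge> 0\<close> by (intro has_derivative_subset[OF F]) auto
    have "((\<lambda>x. (x, t)) has_derivative (\<lambda>h. (h, 0))) (at x)"
      by (auto intro!: derivative_eq_intros)
    from has_derivative_in_compose[OF this F2]
    have "((\<lambda>x. u x t) has_derivative (\<lambda>h. F' (x, t) (h, 0))) (at x)"
      by simp
    moreover have "(\<lambda>h. F' (x, t) (h, 0)) = (*) (F' (x, t) (1, 0))"
    proof
      fix h :: real
      have "F' (x, t) (h *\<^sub>R (1, 0)) = h *\<^sub>R F' (x, t) (1, 0)"
        by (rule linear_scale) (use F in \<open>simp add: has_derivative_linear\<close>)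
      then show "F' (x, t) (h, 0) = F' (x, t) (1, 0) * h"
        by simp
    qed
    ultimately show "((\<lambda>x. u x t) has_real_derivative F' (x, t) (1, 0)) (at x)"
      by (simp add: has_field_derivative_def)
  qed
qed

text \<open>
  The \<open>xx\<close> and \<open>yy\<close> components of the flow, with \<open>S = g\<^sub>s\<^sub>s\<close> and \<open>g\<^sub>s = g\<^sub>x / f\<close>. The flow
  differentiates \<open>f\<^sup>2\<close> and \<open>g\<^sup>2\<close> in time; taking square roots passes to \<open>f\<close> and \<open>g\<close>.
\<close>

lemma cross_curvature_flow_imp_pde:
  fixes f g fx gx gxx :: "real \<Rightarrow> real \<Rightarrow> real"
  assumes flow: "cross_curvature_flow
                   (\<lambda>t. square_torus_bundle_metric (\<lambda>x. f x t) (\<lambda>x. g x t))"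
    and f_pos: "\<And>x t. t \<ge> 0 \<Longrightarrow> f x t > 0"
    and g_pos: "\<And>x t. t \<ge> 0 \<Longrightarrow> g x t > 0"
    and df: "\<And>x t. t \<ge> 0 \<Longrightarrow> ((\<lambda>x. f x t) has_real_derivative fx x t) (at x)"
    and dg: "\<And>x t. t \<ge> 0 \<Longrightarrow> ((\<lambda>x. g x t) has_real_derivative gx x t) (at x)"
    and dgx: "\<And>x t. t \<ge> 0 \<Longrightarrow> ((\<lambda>x. gx x t) has_real_derivative gxx x t) (at x)"
    and t: "t \<ge> 0"
  defines "S \<equiv> \<lambda>x t. second_arclength_derivative (f x t) (fx x t) (gx x t) (gxx x t)"
  shows "((\<lambda>\<tau>. f x \<tau>) has_real_derivative f x t * (S x t)\<^sup>2 / (g x t)\<^sup>2) (at t within {0..})"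
    and "((\<lambda>\<tau>. g x \<tau>) has_real_derivative (gx x t / f x t)\<^sup>2 * S x t / (g x t)\<^sup>2)
           (at t within {0..})"
proof -
  define p :: "real^3" where "p = (\<chi> i. x)"
  let ?G = "\<lambda>\<tau>. square_torus_bundle_metric (\<lambda>x. f x \<tau>) (\<lambda>x. g x \<tau>) p"
  have pos: "f x t > 0" "g x t > 0" using f_pos g_pos t by auto
  have "cross_curvature (square_torus_bundle_metric (\<lambda>x. f x t) (\<lambda>x. g x t)) p
      = axial_matrix ((f x t * S x t / g x t)\<^sup>2) ((gx x t / f x t)\<^sup>2 * S x t / g x t)"
    by (subst cross_curvature_bundle_metric[OF f_pos g_pos df dg dgx])
      (use t in \<open>auto simp: S_def p_def \<close>)
  moreover have "(?G has_vector_derivative 2 *\<^sub>R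
      cross_curvature (square_torus_bundle_metric (\<lambda>x. f x t) (\<lambda>x. g x t)) p) (at t within {0..})"
    using flow t by (simp add: cross_curvature_flow_def)
  ultimately have "(?G has_vector_derivative
      2 *\<^sub>R axial_matrix ((f x t * S x t / g x t)\<^sup>2) ((gx x t / f x t)\<^sup>2 * S x t / g x t))
      (at t within {0..})"
    by simp
  then have G: "((\<lambda>\<tau>. ?G \<tau> $ i $ i) has_vector_derivative
      (2 *\<^sub>R axial_matrix ((f x t * S x t / g x t)\<^sup>2) ((gx x t / f x t)\<^sup>2 * S x t / g x t)) $ i $ i)
      (at t within {0..})" for i
    by (intro bounded_linear.has_vector_derivative[OF bounded_linear_vec_nth])
  have f2: "((\<lambda>\<tau>. (f x \<tau>)\<^sup>2) has_real_derivative 2 * (f x t * S x t / g x t)\<^sup>2) (at t within {0..})"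
    using G[of 1]
    by (simp add: square_torus_bundle_metric_eq axial_matrix_nth p_def
        has_real_derivative_iff_has_vector_derivative)
  have g2: "((\<lambda>\<tau>. (g x \<tau>)\<^sup>2) has_real_derivative 2 * ((gx x t / f x t)\<^sup>2 * S x t / g x t))
      (at t within {0..})"
    using G[of 2]
    by (simp add: square_torus_bundle_metric_eq axial_matrix_nth p_def
        has_real_derivative_iff_has_vector_derivative)
  have root: "(h has_real_derivative D / (2 * h t)) (at t within {0..})"
    if "((\<lambda>\<tau>. (h \<tau>)\<^sup>2) has_real_derivative D) (at t within {0..})" "\<And>\<tau>. \<tau> \<ge> 0 \<Longrightarrow> h \<tau> > 0"
    for h D
  proof (rule has_field_derivative_transform_within[OF _ zero_less_one])
    have "((\<lambda>\<tau>. sqrt ((h \<tau>)\<^sup>2)) has_real_derivative inverse (sqrt ((h t)\<^sup>2)) / 2 * D)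
        (at t within {0..})"
      using that(2)[OF t] by (intro DERIV_chain2[OF DERIV_real_sqrt that(1)]) simp
    then show "((\<lambda>\<tau>. sqrt ((h \<tau>)\<^sup>2)) has_real_derivative D / (2 * h t)) (at t within {0..})"
      using that(2)[OF t] by (simp add: field_simps)
  qed (use t that(2) in \<open>auto simp: less_imp_le\<close>)
  show "((\<lambda>\<tau>. f x \<tau>) has_real_derivative f x t * (S x t)\<^sup>2 / (g x t)\<^sup>2) (at t within {0..})"
    using root[OF f2 f_pos] pos by (simp add: field_simps power2_eq_square)
  show "((\<lambda>\<tau>. g x \<tau>) has_real_derivative (gx x t / f x t)\<^sup>2 * S x t / (g x t)\<^sup>2)
           (at t within {0..})"
    using root[OF g2 g_pos] pos by (simp add: field_simps power2_eq_square)
qed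

section \<open>Critical points and growth of the length\<close>

lemma periodic_continuous_attains_sup:
  fixes h :: "real \<Rightarrow> real"
  assumes per: "\<And>x. h (x + 1) = h x" and cont: "continuous_on UNIV h"
  obtains p where "p \<in> {0..1}" "\<And>x. h x \<le> h p"
proof -
  interpret periodic_fun_simple' h
    by unfold_locales (rule per)
  obtain p where p: "p \<in> {0..1}" "\<And>x. x \<in> {0..1} \<Longrightarrow> h x \<le> h p"
    using continuous_attains_sup[of "{0..1}" h] continuous_on_subset[OF cont] by auto
  show ?thesis
  proof (rule that[OF p(1)])
    fix x
    have "h x = h (frac x + of_int \<lfloor>x\<rfloor>)" by (simp add: frac_def)
    also have "\<dots> = h (frac x)" by (rule plus_of_int)
    also have "\<dots> \<le> h p"
      by (rule p(2)) (simp add: less_imp_le frac_lt_1)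
    finally show "h x \<le> h p" .
  qed
qed

text \<open>
  The cross curvature flow of square torus bundle metrics as a system of partial differential
  equations. With \<open>ds = f dx\<close>, the functions \<open>\<sigma>\<close>, \<open>S\<close>, \<open>S'\<close> are the first, second and third
  derivatives of \<open>g\<close> with respect to \<open>s\<close>. Functions on the circle are represented by
  functions on the line; the argument uses the periodicity of \<open>g\<close> only.
\<close>

locale torus_bundle_pde =
  fixes f g \<sigma> S S' :: "real \<Rightarrow> real \<Rightarrow> real"
  assumes g_periodic: "\<And>x t. t \<ge> 0 \<Longrightarrow> g (x + 1) t = g x t"
    and f_pos: "\<And>x t. t \<ge> 0 \<Longrightarrow> f x t > 0"
    and g_pos: "\<And>x t. t \<ge> 0 \<Longrightarrow> g x t > 0"
    and cont: "continuous_on (UNIV \<times> {0..}) (\<lambda>p. f (fst p) (snd p))"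
      "continuous_on (UNIV \<times> {0..}) (\<lambda>p. g (fst p) (snd p))"
      "continuous_on (UNIV \<times> {0..}) (\<lambda>p. \<sigma> (fst p) (snd p))"
      "continuous_on (UNIV \<times> {0..}) (\<lambda>p. S (fst p) (snd p))"
      "continuous_on (UNIV \<times> {0..}) (\<lambda>p. S' (fst p) (snd p))"
    and dg: "\<And>x t. t \<ge> 0 \<Longrightarrow> ((\<lambda>x. g x t) has_real_derivative f x t * \<sigma> x t) (at x)"
    and d\<sigma>: "\<And>x t. t \<ge> 0 \<Longrightarrow> ((\<lambda>x. \<sigma> x t) has_real_derivative f x t * S x t) (at x)"
    and dS: "\<And>x t. t \<ge> 0 \<Longrightarrow> ((\<lambda>x. S x t) has_real_derivative f x t * S' x t) (at x)"
    and evolution_f: "\<And>x t. t \<ge> 0 \<Longrightarrow>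
      ((\<lambda>t. f x t) has_real_derivative f x t * (S x t)\<^sup>2 / (g x t)\<^sup>2) (at t within {0..})"
    and evolution_g: "\<And>x t. t \<ge> 0 \<Longrightarrow>
      ((\<lambda>t. g x t) has_real_derivative (\<sigma> x t)\<^sup>2 * S x t / (g x t)\<^sup>2) (at t within {0..})"
begin

lemma nonzero [simp]: "t \<ge> 0 \<Longrightarrow> f x t \<noteq> 0" "t \<ge> 0 \<Longrightarrow> g x t \<noteq> 0"
  using f_pos[of t x] g_pos[of t x] by auto

text \<open>
  The coefficient of the linear equation \<open>\<partial>\<^sub>t g\<^sub>x = log_rate * g\<^sub>x\<close>, obtained by differentiating
  \<open>g\<^sub>t = g\<^sub>s\<^sup>2 g\<^sub>s\<^sub>s / g\<^sup>2\<close> in \<open>x\<close>. The factor \<open>g\<^sub>x\<close> splits off because \<open>g\<^sub>t\<close> contains the square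
  of \<open>g\<^sub>s\<close>.
\<close>

definition log_rate :: "real \<Rightarrow> real \<Rightarrow> real" where
  "log_rate x t = 2 * (S x t)\<^sup>2 / (g x t)\<^sup>2 + \<sigma> x t * S' x t / (g x t)\<^sup>2
             - 2 * (\<sigma> x t)\<^sup>2 * S x t / (g x t) ^ 3"

lemma cont_log_rate: "continuous_on (UNIV \<times> {0..}) (\<lambda>p. log_rate (fst p) (snd p))"
  unfolding log_rate_def by (intro continuous_intros cont) auto

lemma continuous_on_time:
  assumes "continuous_on (UNIV \<times> {0..}) (\<lambda>p. u (fst p) (snd p))"
  shows "continuous_on {0..T} (\<lambda>t. u x t :: real)"
  by (rule continuous_on_compose2[OF assms, of _ "\<lambda>t. (x, t)", unfolded fst_conv snd_conv])
    (auto intro!: continuous_intros)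

lemma continuous_on_space:
  assumes "continuous_on (UNIV \<times> {0..}) (\<lambda>p. u (fst p) (snd p))" "t \<ge> 0"
  shows "continuous_on A (\<lambda>x. u x t :: real)"
  by (rule continuous_on_compose2[OF assms(1), of _ "\<lambda>x. (x, t)", unfolded fst_conv snd_conv])
    (use assms(2) in \<open>auto intro!: continuous_intros\<close>)

lemmas cont_space = cont[THEN continuous_on_space]

text \<open>
  The integrated form of \<open>\<partial>\<^sub>t g\<^sub>x = log_rate * g\<^sub>x\<close>, where \<open>g\<^sub>x = f \<sigma>\<close>. Differentiating the
  identity \<open>g(x, T) - g(x, 0) = \<integral>\<^sub>0\<^sup>T g\<^sub>t(x, \<tau>) d\<tau>\<close> under the integral sign avoids interchanging
  mixed partial derivatives of \<open>g\<close>.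
\<close>

lemma g_x_integral_equation:
  assumes T: "T \<ge> 0"
  shows "f x T * \<sigma> x T - f x 0 * \<sigma> x 0 = integral {0..T} (\<lambda>\<tau>. f x \<tau> * \<sigma> x \<tau> * log_rate x \<tau>)"
proof -
  define v where "v x t = (\<sigma> x t)\<^sup>2 * S x t / (g x t)\<^sup>2" for x t
  have v: "continuous_on (UNIV \<times> {0..}) (\<lambda>p. v (fst p) (snd p))"
    unfolding v_def by (intro continuous_intros cont) auto
  have "((\<lambda>x. integral (cbox 0 T) (v x)) has_real_derivative
      integral (cbox 0 T) (\<lambda>\<tau>. f x \<tau> * \<sigma> x \<tau> * log_rate x \<tau>)) (at x within UNIV)"
  proof (rule leibniz_rule_field_derivative)
    fix y \<tau> :: real assume \<tau>: "\<tau> \<in> cbox 0 T"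
    then have "g y \<tau> \<noteq> 0" by simp
    with \<tau> show "((\<lambda>x. v x \<tau>) has_real_derivative f y \<tau> * \<sigma> y \<tau> * log_rate y \<tau>) (at y)"
      unfolding v_def log_rate_def
      by (auto intro!: derivative_eq_intros dg d\<sigma> dS)
        (simp add: field_simps power2_eq_square power3_eq_cube power4_eq_xxxx)
  next
    show "v y integrable_on cbox 0 T" for y
      using continuous_on_time[OF v] by (auto intro: integrable_continuous_interval)
  next
    have "continuous_on (UNIV \<times> {0..})
        (\<lambda>p. f (fst p) (snd p) * \<sigma> (fst p) (snd p) * log_rate (fst p) (snd p))"
      by (intro continuous_intros cont cont_log_rate)
    then show "continuous_on (UNIV \<times> cbox 0 T) (\<lambda>(x, \<tau>). f x \<tau> * \<sigma> x \<tau> * log_rate x \<tau>)"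
      unfolding case_prod_unfold by (rule continuous_on_subset) auto
  qed auto
  moreover have "integral (cbox 0 T) (v x) = g x T - g x 0" for x
  proof -
    have "(v x has_integral g x T - g x 0) {0..T}"
      unfolding v_def using T
      by (intro fundamental_theorem_of_calculus)
        (auto simp flip: has_real_derivative_iff_has_vector_derivative
          intro!: has_field_derivative_subset[OF evolution_g])
    then show ?thesis by (simp add: integral_unique)
  qed
  ultimately have "((\<lambda>x. g x T - g x 0) has_real_derivative
      integral {0..T} (\<lambda>\<tau>. f x \<tau> * \<sigma> x \<tau> * log_rate x \<tau>)) (at x)"
    by simp
  moreover have "((\<lambda>x. g x T - g x 0) has_real_derivative f x T * \<sigma> x T - f x 0 * \<sigma> x 0) (at x)"
    using T by (intro derivative_intros dg) auto
  ultimately show ?thesis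
    by (metis DERIV_unique)
qed

text \<open>
  A solution of a linear ordinary differential equation that vanishes at one time vanishes at
  all times. The times \<open>t1\<close> and \<open>t2\<close> are in no particular order; both directions are
  used below.
\<close>

lemma critical_point_persists:
  assumes "t1 \<ge> 0" "t2 \<ge> 0" "\<sigma> x t1 = 0"
  shows "\<sigma> x t2 = 0"
proof -
  define T where "T = max t1 t2"
  define w where "w t = f x t * \<sigma> x t" for t
  define E where "E t = integral {0..t} (log_rate x)" for t
  have B: "continuous_on {0..T} (log_rate x)"
    by (rule continuous_on_time[OF cont_log_rate])
  have wB: "continuous_on {0..T} (\<lambda>t. w t * log_rate x t)"
    unfolding w_def by (intro continuous_intros B continuous_on_time cont)
  have dw: "(w has_real_derivative w t * log_rate x t) (at t within {0..T})" if t: "t \<in> {0..T}" for t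
  proof (rule has_field_derivative_transform_within[OF _ zero_less_one t])
    show "w 0 + integral {0..s} (\<lambda>t. w t * log_rate x t) = w s" if "s \<in> {0..T}" for s
      using g_x_integral_equation[of s x] that by (simp add: w_def)
    show "((\<lambda>s. w 0 + integral {0..s} (\<lambda>t. w t * log_rate x t)) has_real_derivative w t * log_rate x t)
        (at t within {0..T})"
      by (auto intro!: derivative_eq_intros integral_has_real_derivative[OF wB t])
  qed
  have dE: "(E has_real_derivative log_rate x t) (at t within {0..T})" if "t \<in> {0..T}" for t
    unfolding E_def by (rule integral_has_real_derivative[OF B that])
  \<comment> \<open>\<open>exp (- E)\<close> is an integrating factor for \<open>w' = log_rate * w\<close>\<close>
  have "\<exists>c. \<forall>t\<in>{0..T}. w t * exp (- E t) = c"
    by (rule has_field_derivative_zero_constant)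
      (auto intro!: derivative_eq_intros dw dE)
  then obtain c where c: "\<And>t. t \<in> {0..T} \<Longrightarrow> w t * exp (- E t) = c" by blast
  have "w t1 * exp (- E t1) = w t2 * exp (- E t2)"
    using c[of t1] c[of t2] assms by (simp add: T_def)
  with assms have "w t2 = 0" by (simp add: w_def)
  with assms show ?thesis by (simp add: w_def)
qed

lemma critical_value_constant:
  assumes "t1 \<ge> 0" "t2 \<ge> 0" "\<sigma> x t1 = 0"
  shows "g x t2 = g x t1"
proof -
  have "((\<lambda>t. g x t) has_real_derivative 0) (at t within {0..})" if "t \<in> {0..}" for t
    using evolution_g[of t x] critical_point_persists[of t1 t x] assms that by simp
  then obtain c where "\<And>t. t \<in> {0..} \<Longrightarrow> g x t = c"
    using has_field_derivative_zero_constant[of "{0..}" "\<lambda>t. g x t"] by auto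
  with assms show ?thesis by simp
qed

lemma critical_point_at_max:
  assumes "t \<ge> 0" "\<And>x. g x t \<le> g p t"
  shows "\<sigma> p t = 0"
proof -
  have "f p t * \<sigma> p t = 0"
    by (rule DERIV_local_max[OF dg zero_less_one]) (use assms in auto)
  with assms show ?thesis by simp
qed

lemma critical_point_at_min:
  assumes "t \<ge> 0" "\<And>x. g p t \<le> g x t"
  shows "\<sigma> p t = 0"
proof -
  have "f p t * \<sigma> p t = 0"
    by (rule DERIV_local_min[OF dg zero_less_one]) (use assms in auto)
  with assms show ?thesis by simp
qed

lemma exists_spatial_max:
  assumes "t \<ge> 0"
  obtains p where "p \<in> {0..1}" "\<And>x. g x t \<le> g p t"
  using periodic_continuous_attains_sup[of "\<lambda>x. g x t"] g_periodic
    continuous_on_space[OF cont(2)] assms by blast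

lemma exists_spatial_min:
  assumes "t \<ge> 0"
  obtains p where "p \<in> {0..1}" "\<And>x. g p t \<le> g x t"
proof -
  obtain p where "p \<in> {0..1}" "\<And>x. - g x t \<le> - g p t"
    using periodic_continuous_attains_sup[of "\<lambda>x. - g x t"] g_periodic assms
      continuous_on_minus[OF continuous_on_space[OF cont(2)]] by auto
  with that show ?thesis by auto
qed

lemma length_derivative:
  assumes t: "t \<ge> 0"
  shows "((\<lambda>t. integral {0..1} (\<lambda>x. f x t)) has_real_derivative
           integral {0..1} (\<lambda>x. f x t * (S x t)\<^sup>2 / (g x t)\<^sup>2)) (at t within {0..})"
proof -
  let ?v = "\<lambda>x t. f x t * (S x t)\<^sup>2 / (g x t)\<^sup>2"
  have "((\<lambda>t. integral (cbox 0 1) (\<lambda>x. f x t)) has_real_derivative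
      integral (cbox 0 1) (\<lambda>x. ?v x t)) (at t within {0..})"
  proof (rule leibniz_rule_field_derivative)
    have v: "continuous_on (UNIV \<times> {0..}) (\<lambda>p. ?v (fst p) (snd p))"
      by (intro continuous_intros cont) auto
    show "continuous_on ({0..} \<times> cbox 0 1) (\<lambda>(t, x). ?v x t)"
      unfolding case_prod_unfold
      by (rule continuous_on_compose2[OF v, of _ "\<lambda>p. (snd p, fst p)", unfolded fst_conv snd_conv])
        (auto intro!: continuous_intros)
  qed (use t in \<open>auto intro!: evolution_f integrable_continuous_interval cont_space\<close>)
  then show ?thesis by simp
qed

text \<open>
  The extreme values of \<open>g\<close> at time \<open>0\<close> are attained at critical points, so they are still
  attained, at the same points, at every later time. This keeps the oscillation of \<open>g\<close> bounded
  below and yields \<open>L' = \<integral> g\<^sub>s\<^sub>s\<^sup>2 / g\<^sup>2 ds \<ge> (\<delta>\<^sup>2 / M\<^sup>2) / L\<^sup>3\<close>.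
\<close>

lemma length_tends_to_infinity:
  assumes nonconst: "g p 0 < g q 0"
  shows "filterlim (\<lambda>t. integral {0..1} (\<lambda>x. f x t)) at_top at_top"
proof -
  obtain a where a: "a \<in> {0..1}" "\<And>x. g x 0 \<le> g a 0"
    using exists_spatial_max[of 0] by auto
  obtain b where b: "b \<in> {0..1}" "\<And>x. g b 0 \<le> g x 0"
    using exists_spatial_min[of 0] by auto
  have crit: "\<sigma> a 0 = 0" "\<sigma> b 0 = 0"
    using critical_point_at_max critical_point_at_min a b by auto
  define M where "M = g a 0"
  define \<delta> where "\<delta> = g a 0 - g b 0"
  have M: "M > 0" using g_pos by (simp add: M_def)
  have \<delta>: "\<delta> > 0" using nonconst a(2)[of q] b(2)[of p] by (simp add: \<delta>_def)
  have upper: "g x t \<le> M" if t: "t \<ge> 0" for x t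
  proof -
    \<comment> \<open>a maximum point at time \<open>t\<close> was already critical at time \<open>0\<close>, with the same value\<close>
    obtain m where m: "m \<in> {0..1}" "\<And>x. g x t \<le> g m t"
      using exists_spatial_max[OF t] by auto
    have "\<sigma> m t = 0" using critical_point_at_max[OF t] m by auto
    then have "g m t = g m 0" using critical_value_constant[of t 0 m] t by simp
    then show ?thesis using m(2)[of x] a(2)[of m] by (simp add: M_def)
  qed
  let ?L = "\<lambda>t. integral {0..1} (\<lambda>x. f x t)"
  show ?thesis
  proof (rule filterlim_at_top_of_cubic_growth[of _ _ "\<delta>\<^sup>2 / M\<^sup>2"])
    fix t :: real assume t: "t \<ge> 0"
    show "(?L has_real_derivative integral {0..1} (\<lambda>x. f x t * (S x t)\<^sup>2 / (g x t)\<^sup>2))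
        (at t within {0..})"
      by (rule length_derivative[OF t])
    show "?L t > 0"
      using f_pos[OF t] by (intro integral_pos_of_continuous_pos cont_space t)
    have "(g a t - g b t)\<^sup>2 / (?L t) ^ 3 \<le> integral {0..1} (\<lambda>x. f x t * (S x t)\<^sup>2)"
    proof (rule bending_energy_lower_bound[where c = a and u = "\<lambda>x. g x t" and \<sigma> = "\<lambda>x. \<sigma> x t"])
      show "\<sigma> a t = 0" using critical_point_persists[of 0 t a] crit t by simp
    qed (use a b t in \<open>auto intro!: cont_space f_pos
          has_field_derivative_at_within[OF dg] has_field_derivative_at_within[OF d\<sigma>]\<close>)
    moreover have "g a t - g b t = \<delta>"
      using critical_value_constant[of 0 t] crit t by (simp add: \<delta>_def)
    ultimately have J: "\<delta>\<^sup>2 / (?L t) ^ 3 \<le> integral {0..1} (\<lambda>x. f x t * (S x t)\<^sup>2)"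
      by simp
    have "\<delta>\<^sup>2 / M\<^sup>2 / (?L t) ^ 3 = (\<delta>\<^sup>2 / (?L t) ^ 3) / M\<^sup>2"
      by simp
    also have "\<dots> \<le> integral {0..1} (\<lambda>x. f x t * (S x t)\<^sup>2) / M\<^sup>2"
      using J by (rule divide_right_mono) simp
    also have "\<dots> = integral {0..1} (\<lambda>x. f x t * (S x t)\<^sup>2 / M\<^sup>2)"
      by simp
    also have "\<dots> \<le> integral {0..1} (\<lambda>x. f x t * (S x t)\<^sup>2 / (g x t)\<^sup>2)"
    proof (intro integral_le integrable_continuous_interval continuous_intros cont_space t)
      fix x :: real
      have "(g x t)\<^sup>2 \<le> M\<^sup>2"
        using upper[OF t] g_pos[OF t, of x] by (intro power_mono) auto
      then show "f x t * (S x t)\<^sup>2 / M\<^sup>2 \<le> f x t * (S x t)\<^sup>2 / (g x t)\<^sup>2"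
        using f_pos[OF t, of x] t g_pos[OF t, of x] M
        by (intro divide_left_mono) auto
    qed (use M t in auto)
    finally show "\<delta>\<^sup>2 / M\<^sup>2 / (?L t) ^ 3
        \<le> integral {0..1} (\<lambda>x. f x t * (S x t)\<^sup>2 / (g x t)\<^sup>2)" .
  qed (use \<delta> M in simp)
qed

end

section \<open>Divergence of the length\<close>

theorem theorem6:
  fixes f g :: "real \<Rightarrow> real \<Rightarrow> real"
  assumes f_periodic: "\<And>x t. t \<ge> 0 \<Longrightarrow> f (x + 1) t = f x t"
    and g_periodic: "\<And>x t. t \<ge> 0 \<Longrightarrow> g (x + 1) t = g x t"
    and f_pos: "\<And>x t. t \<ge> 0 \<Longrightarrow> f x t > 0"
    and g_pos: "\<And>x t. t \<ge> 0 \<Longrightarrow> g x t > 0"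
    and f_smooth: "smooth_on (\<lambda>(x, t). f x t) (UNIV \<times> {0..})"
    and g_smooth: "smooth_on (\<lambda>(x, t). g x t) (UNIV \<times> {0..})"
    and flow: "cross_curvature_flow
                 (\<lambda>t. square_torus_bundle_metric (\<lambda>x. f x t) (\<lambda>x. g x t))"
    and nonconst: "(SUP x. g x 0) > (INF x. g x 0)"
  shows "filterlim (\<lambda>t. integral {0..1} (\<lambda>x. f x t)) at_top at_top"
proof -
  have nz: "f x t \<noteq> 0" "g x t \<noteq> 0" if "t \<ge> 0" for x t
    using f_pos[OF that, of x] g_pos[OF that, of x] by auto
  have "k_times_differentiable_on (Suc (Suc 0)) (\<lambda>(x, t). f x t) (UNIV \<times> {0..})"
    using f_smooth unfolding smooth_on_def by blast
  then obtain fx :: "real \<Rightarrow> real \<Rightarrow> real" where fx1: "k_times_differentiable_on (Suc 0) (\<lambda>(x, t). fx x t) (UNIV \<times> {0..})"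
    and df: "\<And>x t. t \<ge> 0 \<Longrightarrow> ((\<lambda>x. f x t) has_real_derivative fx x t) (at x)"
    by (rule k_times_differentiable_on_partial_fst) blast
  from fx1 obtain fxx :: "real \<Rightarrow> real \<Rightarrow> real" where fxx0: "k_times_differentiable_on 0 (\<lambda>(x, t). fxx x t) (UNIV \<times> {0..})"
    and dfx: "\<And>x t. t \<ge> 0 \<Longrightarrow> ((\<lambda>x. fx x t) has_real_derivative fxx x t) (at x)"
    by (rule k_times_differentiable_on_partial_fst) blast
  have "k_times_differentiable_on (Suc (Suc (Suc 0))) (\<lambda>(x, t). g x t) (UNIV \<times> {0..})"
    using g_smooth unfolding smooth_on_def by blast
  then obtain gx :: "real \<Rightarrow> real \<Rightarrow> real" where
      gx2: "k_times_differentiable_on (Suc (Suc 0)) (\<lambda>(x, t). gx x t) (UNIV \<times> {0..})"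
    and dg: "\<And>x t. t \<ge> 0 \<Longrightarrow> ((\<lambda>x. g x t) has_real_derivative gx x t) (at x)"
    by (rule k_times_differentiable_on_partial_fst) blast
  from gx2 obtain gxx :: "real \<Rightarrow> real \<Rightarrow> real" where
      gxx1: "k_times_differentiable_on (Suc 0) (\<lambda>(x, t). gxx x t) (UNIV \<times> {0..})"
    and dgx: "\<And>x t. t \<ge> 0 \<Longrightarrow> ((\<lambda>x. gx x t) has_real_derivative gxx x t) (at x)"
    by (rule k_times_differentiable_on_partial_fst) blast
  from gxx1 obtain gxxx :: "real \<Rightarrow> real \<Rightarrow> real" where
      gxxx0: "k_times_differentiable_on 0 (\<lambda>(x, t). gxxx x t) (UNIV \<times> {0..})"
    and dgxx: "\<And>x t. t \<ge> 0 \<Longrightarrow> ((\<lambda>x. gxx x t) has_real_derivative gxxx x t) (at x)"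
    by (rule k_times_differentiable_on_partial_fst) blast
  have cont: "continuous_on (UNIV \<times> {0..}) (\<lambda>p. u (fst p) (snd p))"
    if "k_times_differentiable_on k (\<lambda>(x, t). u x t) (UNIV \<times> {0..})"
    for k and u :: "real \<Rightarrow> real \<Rightarrow> real"
    using k_times_differentiable_on_imp_continuous_on[OF that] by (simp add: case_prod_unfold)
  have smooth_cont: "continuous_on (UNIV \<times> {0..}) (\<lambda>p. f (fst p) (snd p))"
    "continuous_on (UNIV \<times> {0..}) (\<lambda>p. g (fst p) (snd p))"
    using f_smooth g_smooth cont unfolding smooth_on_def by blast+
  note conts = smooth_cont cont[OF fx1] cont[OF fxx0] cont[OF gx2] cont[OF gxx1] cont[OF gxxx0]
  define S where "S x t = second_arclength_derivative (f x t) (fx x t) (gx x t) (gxx x t)" for x t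
  \<comment> \<open>the expansion of \<open>(1/f) \<partial>\<^sub>x S\<close>\<close>
  define S' where "S' x t =
      (gxxx x t / (f x t)\<^sup>2 - 3 * fx x t * gxx x t / (f x t) ^ 3 - fxx x t * gx x t / (f x t) ^ 3
       + 3 * (fx x t)\<^sup>2 * gx x t / (f x t) ^ 4) / f x t" for x t
  interpret torus_bundle_pde f g "\<lambda>x t. gx x t / f x t" S S'
  proof
    fix x t :: real assume t: "t \<ge> 0"
    note nzt = nz[OF t]
    show "((\<lambda>x. g x t) has_real_derivative f x t * (gx x t / f x t)) (at x)"
      using dg[OF t, of x] nzt by simp
    show "((\<lambda>x. gx x t / f x t) has_real_derivative f x t * S x t) (at x)"
      unfolding S_def second_arclength_derivative_def using nzt
      by (auto intro!: derivative_eq_intros dgx[OF t] df[OF t])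
        (simp add: field_simps power2_eq_square power3_eq_cube)
    show "((\<lambda>x. S x t) has_real_derivative f x t * S' x t) (at x)"
      unfolding S_def S'_def second_arclength_derivative_def using nzt
      by (auto intro!: derivative_eq_intros dgx[OF t] df[OF t] dgxx[OF t] dfx[OF t])
        (simp add: field_simps eval_nat_numeral)
    show "((\<lambda>t. f x t) has_real_derivative f x t * (S x t)\<^sup>2 / (g x t)\<^sup>2) (at t within {0..})"
      "((\<lambda>t. g x t) has_real_derivative (gx x t / f x t)\<^sup>2 * S x t / (g x t)\<^sup>2) (at t within {0..})"
      using cross_curvature_flow_imp_pde[OF flow f_pos g_pos df dg dgx t, of x]
      by (simp_all add: S_def)
  qed (use f_pos g_pos g_periodic nz in
      \<open>auto simp: S_def S'_def second_arclength_derivative_def intro!: continuous_intros conts\<close>)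
  obtain a where a: "\<And>x. g x 0 \<le> g a 0"
    using exists_spatial_max[of 0] by auto
  obtain b where b: "\<And>x. g b 0 \<le> g x 0"
    using exists_spatial_min[of 0] by auto
  have "g b 0 \<le> (INF x. g x 0)" by (rule cINF_greatest) (use b in auto)
  also have "\<dots> < (SUP x. g x 0)" by (rule nonconst)
  also have "\<dots> \<le> g a 0" by (rule cSUP_least) (use a in auto)
  finally show ?thesis by (rule length_tends_to_infinity)
qed

end
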